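(* Let $A$ be an algebra over a field $\mathbb{F}$ with more than two elements. Then a right $A$-module $M$ is automorphism-invariant if and only if $M$ is quasi-injective.
   Context: Algebras are associative with identity; modules are unital right modules. $E(M)$ denotes the injective hull of $M$. A module $M$ is quasi-injective if every homomorphism from a submodule $L$ of $M$ to $M$ extends to an endomorphism of $M$ (equivalently, $\varphi(M)\subseteq M$ for every endomorphism $\varphi$ of $E(M)$). A module $M$ is automorphism-invariant if $\sigma(M)\subseteq M$ for every automorphism $\sigma$ of $E(M)$. *)

theory Defs
  imports Main
begin

text \<open>An algebra over a field: a ring A (type 'a) with a unital ring homomorphism
  phi from the field F (type 'k) into the centre of A; the scalar action is c.a = phi c * a.\<close>
definition F_algebra :: "('k::field \<Rightarrow> 'a::ring_1) \<Rightarrow> bool" where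
  "F_algebra phi \<longleftrightarrow> phi 1 = 1 \<and> (\<forall>x y. phi (x + y) = phi x + phi y)
     \<and> (\<forall>x y. phi (x * y) = phi x * phi y) \<and> (\<forall>c a. phi c * a = a * phi c)"

definition right_module :: "('m::ab_group_add \<Rightarrow> 'a::ring_1 \<Rightarrow> 'm) \<Rightarrow> bool" where
  "right_module act \<longleftrightarrow> (\<forall>x y a. act (x + y) a = act x a + act y a)
     \<and> (\<forall>x a b. act x (a + b) = act x a + act x b)
     \<and> (\<forall>x a b. act x (a * b) = act (act x a) b)
     \<and> (\<forall>x. act x 1 = x)"

definition submodule :: "('m::ab_group_add \<Rightarrow> 'a::ring_1 \<Rightarrow> 'm) \<Rightarrow> 'm set \<Rightarrow> bool" where
  "submodule act L \<longleftrightarrow> 0 \<in> L \<and> (\<forall>x\<in>L. \<forall>y\<in>L. x + y \<in> L) \<and> (\<forall>x\<in>L. - x \<in> L)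
     \<and> (\<forall>x\<in>L. \<forall>a. act x a \<in> L)"

definition module_hom_on :: "('m::ab_group_add \<Rightarrow> 'a::ring_1 \<Rightarrow> 'm) \<Rightarrow> ('n::ab_group_add \<Rightarrow> 'a \<Rightarrow> 'n)
    \<Rightarrow> 'm set \<Rightarrow> ('m \<Rightarrow> 'n) \<Rightarrow> bool" where
  "module_hom_on actM actN L f \<longleftrightarrow> (\<forall>x\<in>L. \<forall>y\<in>L. f (x + y) = f x + f y)
     \<and> (\<forall>x\<in>L. \<forall>a. f (actM x a) = actN (f x) a)"

definition quasi_injective :: "('m::ab_group_add \<Rightarrow> 'a::ring_1 \<Rightarrow> 'm) \<Rightarrow> bool" where
  "quasi_injective act \<longleftrightarrow> (\<forall>L f. submodule act L \<longrightarrow> module_hom_on act act L f \<longrightarrow>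
     (\<exists>g. module_hom_on act act UNIV g \<and> (\<forall>x\<in>L. g x = f x)))"

definition right_ideal :: "'a::ring_1 set \<Rightarrow> bool" where
  "right_ideal I \<longleftrightarrow> submodule (\<lambda>x a. x * a) I"

text \<open>Injectivity of a right module, via Baer's criterion.\<close>
definition injective_module :: "('e::ab_group_add \<Rightarrow> 'a::ring_1 \<Rightarrow> 'e) \<Rightarrow> bool" where
  "injective_module act \<longleftrightarrow> (\<forall>I f. right_ideal I \<longrightarrow> module_hom_on (\<lambda>x a. x * a) act I f \<longrightarrow>
     (\<exists>e. \<forall>x\<in>I. f x = act e x))"

definition essential_submodule :: "('e::ab_group_add \<Rightarrow> 'a::ring_1 \<Rightarrow> 'e) \<Rightarrow> 'e set \<Rightarrow> bool" where
  "essential_submodule act S \<longleftrightarrow> submodule act S \<and>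
     (\<forall>N. submodule act N \<longrightarrow> N \<noteq> {0} \<longrightarrow> N \<inter> S \<noteq> {0})"

definition injective_hull :: "('m::ab_group_add \<Rightarrow> 'a::ring_1 \<Rightarrow> 'm) \<Rightarrow> ('e::ab_group_add \<Rightarrow> 'a \<Rightarrow> 'e)
    \<Rightarrow> ('m \<Rightarrow> 'e) \<Rightarrow> bool" where
  "injective_hull actM actE iota \<longleftrightarrow> right_module actE \<and> injective_module actE
     \<and> module_hom_on actM actE UNIV iota \<and> inj iota \<and> essential_submodule actE (range iota)"

definition module_automorphism :: "('e::ab_group_add \<Rightarrow> 'a::ring_1 \<Rightarrow> 'e) \<Rightarrow> ('e \<Rightarrow> 'e) \<Rightarrow> bool" where
  "module_automorphism act s \<longleftrightarrow> module_hom_on act act UNIV s \<and> bij s"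

text \<open>M (embedded in its injective hull E via iota) is automorphism-invariant.\<close>
definition automorphism_invariant :: "('e::ab_group_add \<Rightarrow> 'a::ring_1 \<Rightarrow> 'e) \<Rightarrow> ('m \<Rightarrow> 'e) \<Rightarrow> bool" where
  "automorphism_invariant actE iota \<longleftrightarrow>
     (\<forall>s. module_automorphism actE s \<longrightarrow> s ` range iota \<subseteq> range iota)"

end

theory Submission
  imports Defs "HOL-Library.Product_Plus"
begin

text \<open>
  Let \<open>E\<close> be the injective hull of \<open>M\<close>. If \<open>M\<close> is automorphism-invariant, the endomorphisms of \<open>E\<close>
  that map \<open>M\<close> into itself form a subring \<open>T\<close> of \<open>End E\<close> containing all units; the point is that
  \<open>T\<close> is all of \<open>End E\<close>. It contains every \<open>n\<close> with essential kernel (\<open>1 - n\<close> is a unit) and every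
  \<open>n\<close> with \<open>n\<^sup>2 = 0\<close> (\<open>1 + n\<close> is a unit). For a scalar \<open>d\<close> different from \<open>0\<close> and \<open>1\<close> and an
  idempotent \<open>e\<close>, \<open>1 + (d - 1) e\<close> is a unit, hence \<open>e\<close> is in \<open>T\<close>. Now take a maximal isomorphism
  between submodules \<open>A\<close> and \<open>B\<close> of \<open>E\<close> with \<open>A \<inter> B = 0\<close> and decompose \<open>E\<close> along the injective hulls
  of \<open>A\<close> and \<open>B\<close> and a complement \<open>C\<close>. Off-diagonal blocks have square zero. An endomorphism of the
  hull of \<open>A\<close> factors through the hull of \<open>B\<close> up to a map with essential kernel, so it is a product of
  off-diagonal blocks, and likewise for \<open>B\<close>. By maximality \<open>C\<close> is square-free (it does not contain
  two disjoint isomorphic nonzero submodules), and then an endomorphism \<open>g\<close> of \<open>C\<close>, modified to be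
  the identity on the hull of its kernel, is an automorphism.
\<close>

section \<open>Submodules and extension of homomorphisms\<close>

text \<open>Zorn's lemma applies because any two elements of the union of a chain lie in one member.
  \<open>R\<close> is binary because the requirement that the two projections of a graph meet only
  in 0 compares two pairs.\<close>

lemma maximal_submodule:
  assumes "submodule act A" and "\<And>p q. p \<in> A \<Longrightarrow> q \<in> A \<Longrightarrow> R p q"
  obtains G where "submodule act G" "A \<subseteq> G" "\<And>p q. p \<in> G \<Longrightarrow> q \<in> G \<Longrightarrow> R p q"
    "\<And>K. submodule act K \<Longrightarrow> G \<subseteq> K \<Longrightarrow> (\<And>p q. p \<in> K \<Longrightarrow> q \<in> K \<Longrightarrow> R p q) \<Longrightarrow> K \<subseteq> G"
proof -
  let ?F = "{G. submodule act G \<and> A \<subseteq> G \<and> (\<forall>p\<in>G. \<forall>q\<in>G. R p q)}"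
  have "\<exists>M\<in>?F. \<forall>X\<in>?F. M \<subseteq> X \<longrightarrow> X = M"
  proof (rule subset_Zorn_nonempty)
    have "A \<in> ?F" using assms by auto
    then show "?F \<noteq> {}" by auto
  next
    fix C assume ne: "C \<noteq> {}" and ch: "subset.chain ?F C"
    have CF: "\<And>X. X \<in> C \<Longrightarrow> X \<in> ?F"
      using ch by (auto simp: subset.chain_def)
    have both: "\<exists>X\<in>C. p \<in> X \<and> q \<in> X" if pq: "p \<in> \<Union>C" "q \<in> \<Union>C" for p q
    proof -
      obtain X Y where XY: "X \<in> C" "Y \<in> C" "p \<in> X" "q \<in> Y" using pq by blast
      then have "X \<subseteq> Y \<or> Y \<subseteq> X" using ch unfolding subset_chain_def by blast
      with XY show ?thesis by blast
    qed
    have sub: "0 \<in> X" "p \<in> X \<Longrightarrow> q \<in> X \<Longrightarrow> p + q \<in> X" "p \<in> X \<Longrightarrow> - p \<in> X"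
      "p \<in> X \<Longrightarrow> act p a \<in> X" if "X \<in> C" for X p q a
      using CF[OF that] unfolding submodule_def by blast+
    have "submodule act (\<Union>C)"
      unfolding submodule_def
    proof (intro conjI ballI allI)
      show "0 \<in> \<Union>C" using ne sub(1) by blast
    next
      fix p q assume "p \<in> \<Union>C" "q \<in> \<Union>C"
      then obtain X where "X \<in> C" "p \<in> X" "q \<in> X" using both by blast
      then show "p + q \<in> \<Union>C" using sub(2) by blast
    next
      fix p assume "p \<in> \<Union>C"
      then show "- p \<in> \<Union>C" using sub(3) by blast
    next
      fix p a assume "p \<in> \<Union>C"
      then show "act p a \<in> \<Union>C" using sub(4) by blast
    qed
    moreover have "A \<subseteq> \<Union>C" using ne CF by auto
    moreover have "\<forall>p\<in>\<Union>C. \<forall>q\<in>\<Union>C. R p q"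
    proof (intro ballI)
      fix p q assume "p \<in> \<Union>C" "q \<in> \<Union>C"
      then obtain X where "X \<in> C" "p \<in> X" "q \<in> X" using both by blast
      then show "R p q" using CF by blast
    qed
    ultimately show "\<Union>C \<in> ?F" by simp
  qed
  then obtain M where M: "M \<in> ?F" and max: "\<forall>X\<in>?F. M \<subseteq> X \<longrightarrow> X = M"
    by (rule bexE)
  show thesis
  proof (rule that[of M])
    fix K assume K: "submodule act K" "M \<subseteq> K" "\<And>p q. p \<in> K \<Longrightarrow> q \<in> K \<Longrightarrow> R p q"
    have "K \<in> ?F"
    proof (intro CollectI conjI ballI)
      show "A \<subseteq> K" using M K(2) by blast
    qed (fact K(1) | rule K(3); assumption)+
    with bspec[OF max this] K(2) show "K \<subseteq> M" by simp
  next
    show "submodule act M" "A \<subseteq> M" using M by blast+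
    show "R p q" if "p \<in> M" "q \<in> M" for p q using M that by blast
  qed
qed

locale rmodule =
  fixes act :: "'m::ab_group_add \<Rightarrow> 'a::ring_1 \<Rightarrow> 'm"
  assumes rmod: "right_module act"
begin

lemma act_simps [simp]:
  "act (x + y) a = act x a + act y a" "act x (a + b) = act x a + act x b"
  "act x (a * b) = act (act x a) b" "act x 1 = x"
  using rmod by (auto simp: right_module_def)

lemma act_zero [simp]: "act 0 a = 0" "act x 0 = 0"
  using act_simps(1)[of 0 0 a] act_simps(2)[of x 0 0] by auto

lemma act_minus [simp]: "act (- x) a = - act x a" "act x (- a) = - act x a"
  using act_simps(1)[of x "- x" a] act_simps(2)[of x a "- a"]
  by (simp_all add: eq_neg_iff_add_eq_0 add.commute)

lemma act_diff [simp]: "act (x - y) a = act x a - act y a" "act x (a - b) = act x a - act x b"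
  using act_simps(1)[of x "- y" a] act_simps(2)[of x a "- b"] by simp_all

lemma submoduleI:
  assumes "0 \<in> L" "\<And>x y. x \<in> L \<Longrightarrow> y \<in> L \<Longrightarrow> x + y \<in> L" "\<And>x a. x \<in> L \<Longrightarrow> act x a \<in> L"
  shows "submodule act L"
proof -
  have "- x \<in> L" if "x \<in> L" for x
    using assms(3)[OF that, of "- 1"] by simp
  with assms show ?thesis unfolding submodule_def by blast
qed

lemma submoduleD:
  assumes "submodule act L"
  shows "0 \<in> L" "\<And>x y. x \<in> L \<Longrightarrow> y \<in> L \<Longrightarrow> x + y \<in> L" "\<And>x a. x \<in> L \<Longrightarrow> act x a \<in> L"
    "\<And>x. x \<in> L \<Longrightarrow> - x \<in> L" "\<And>x y. x \<in> L \<Longrightarrow> y \<in> L \<Longrightarrow> x - y \<in> L"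
proof -
  fix x y assume "x \<in> L" "y \<in> L"
  then have "x + (- y) \<in> L" using assms unfolding submodule_def by blast
  then show "x - y \<in> L" by simp
qed (use assms in \<open>auto simp: submodule_def\<close>)

lemma submodule_UNIV: "submodule act UNIV"
  and submodule_zero: "submodule act {0}"
  by (auto intro: submoduleI)

lemma submodule_sum:
  assumes "submodule act L" "submodule act K"
  shows "submodule act {x + y | x y. x \<in> L \<and> y \<in> K}"
proof (rule submoduleI)
  show "0 \<in> {x + y | x y. x \<in> L \<and> y \<in> K}"
    using assms by (force dest: submoduleD(1))
next
  fix u v assume "u \<in> {x + y | x y. x \<in> L \<and> y \<in> K}" "v \<in> {x + y | x y. x \<in> L \<and> y \<in> K}"
  then obtain x y x' y' where "u = x + y" "v = x' + y'" "x \<in> L" "x' \<in> L" "y \<in> K" "y' \<in> K"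
    by blast
  moreover from this have "u + v = (x + x') + (y + y')" by (simp add: algebra_simps)
  ultimately show "u + v \<in> {x + y | x y. x \<in> L \<and> y \<in> K}"
    using submoduleD(2)[OF assms(1)] submoduleD(2)[OF assms(2)] by blast
next
  fix u a assume "u \<in> {x + y | x y. x \<in> L \<and> y \<in> K}"
  then show "act u a \<in> {x + y | x y. x \<in> L \<and> y \<in> K}"
    using submoduleD(3)[OF assms(1)] submoduleD(3)[OF assms(2)] by fastforce
qed

lemma summand_subset_sum:
  assumes "submodule act L" "submodule act K"
  shows "L \<subseteq> {x + y | x y. x \<in> L \<and> y \<in> K}" "K \<subseteq> {x + y | x y. x \<in> L \<and> y \<in> K}"
  using submoduleD(1)[OF assms(1)] submoduleD(1)[OF assms(2)]
  by (auto intro: add_0_right[symmetric] add_0_left[symmetric])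

end

section \<open>Product modules, and Baer's criterion for partial homomorphisms\<close>

definition pair_act ::
    "('m \<Rightarrow> 'a \<Rightarrow> 'm) \<Rightarrow> ('n \<Rightarrow> 'a \<Rightarrow> 'n) \<Rightarrow> 'm \<times> 'n \<Rightarrow> 'a \<Rightarrow> 'm \<times> 'n" where
  "pair_act actM actN = (\<lambda>p a. (actM (fst p) a, actN (snd p) a))"

lemma fst_pair_act [simp]: "fst (pair_act actM actN p a) = actM (fst p) a"
  and snd_pair_act [simp]: "snd (pair_act actM actN p a) = actN (snd p) a"
  and pair_act_Pair [simp]: "pair_act actM actN (x, y) a = (actM x a, actN y a)"
  by (simp_all add: pair_act_def)

lemma right_module_pair_act:
  assumes "right_module actM" "right_module actN"
  shows "right_module (pair_act actM actN)"
  using assms by (simp add: right_module_def prod_eq_iff)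

lemma module_hom_on_zero_diff:
  assumes "module_hom_on actM actN L f" "rmodule actM" "submodule actM L"
  shows "f 0 = 0" "\<And>x y. x \<in> L \<Longrightarrow> y \<in> L \<Longrightarrow> f (x - y) = f x - f y"
proof -
  interpret rmodule actM by fact
  have add: "f (x + y) = f x + f y" if "x \<in> L" "y \<in> L" for x y
    using assms(1) that by (auto simp: module_hom_on_def)
  show "f 0 = 0" using add[of 0 0] submoduleD(1)[OF assms(3)] by simp
  fix x y assume "x \<in> L" "y \<in> L"
  then show "f (x - y) = f x - f y"
    using add[of "x - y" y] submoduleD(5)[OF assms(3)] by (simp add: algebra_simps)
qed

locale injective_rmodule = rmodule act for act :: "'e::ab_group_add \<Rightarrow> 'a::ring_1 \<Rightarrow> 'e" +
  assumes inj_mod: "injective_module act"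

text \<open>Partial homomorphisms are encoded by their graphs, which are submodules of the product;
  such a submodule is single-valued iff it contains no \<open>(0, y)\<close> with \<open>y \<noteq> 0\<close>.\<close>
lemma (in injective_rmodule) extend_graph:
  assumes "right_module actN" and G0: "submodule (pair_act actN act) G0"
    and sv0: "\<And>y. (0, y) \<in> G0 \<Longrightarrow> y = 0"
  obtains g where "module_hom_on actN act UNIV g" "\<And>x y. (x, y) \<in> G0 \<Longrightarrow> g x = y"
proof -
  interpret N: rmodule actN by (rule rmodule.intro) fact
  interpret P: rmodule "pair_act actN act"
    by (rule rmodule.intro) (rule right_module_pair_act[OF assms(1) rmod])
  obtain G where G: "submodule (pair_act actN act) G" and sub: "G0 \<subseteq> G"
    and sv: "\<And>p q. p \<in> G \<Longrightarrow> q \<in> G \<Longrightarrow> fst p = 0 \<longrightarrow> snd p = 0"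
    and max: "\<And>K. submodule (pair_act actN act) K \<Longrightarrow> G \<subseteq> K \<Longrightarrow>
      (\<And>p q. p \<in> K \<Longrightarrow> q \<in> K \<Longrightarrow> fst p = 0 \<longrightarrow> snd p = 0) \<Longrightarrow> K \<subseteq> G"
    by (rule maximal_submodule[OF G0, where R = "\<lambda>p q. fst p = 0 \<longrightarrow> snd p = 0"])
      (use sv0 in auto)
  note Gadd = P.submoduleD(2)[OF G] and Gact = P.submoduleD(3)[OF G]
    and Gdiff = P.submoduleD(5)[OF G]
  have uniq: "y = y'" if "(x, y) \<in> G" "(x, y') \<in> G" for x y y'
    using sv[OF Gdiff[OF that] Gdiff[OF that]] by simp
  have total: "\<exists>y. (x, y) \<in> G" for x
  proof -
    \<comment> \<open>The scalars that carry \<open>x\<close> into the domain of \<open>G\<close>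
      form a right ideal. Baer's criterion represents the partial map \<open>h\<close> on it by an
      element \<open>e\<close>, the candidate value at \<open>x\<close>.\<close>
    define I where "I = {a. \<exists>y. (actN x a, y) \<in> G}"
    define h where "h a = (THE y. (actN x a, y) \<in> G)" for a
    have h: "h a = y" if "(actN x a, y) \<in> G" for a y
      unfolding h_def using that uniq by blast
    interpret A: rmodule "\<lambda>x a. x * (a :: 'a)"
      by (rule rmodule.intro) (simp add: right_module_def algebra_simps)
    have "submodule (\<lambda>x a. x * a) I"
    proof (rule A.submoduleI)
      show "0 \<in> I" using P.submoduleD(1)[OF G] by (auto simp: I_def zero_prod_def)
    next
      fix a b assume "a \<in> I" "b \<in> I"
      then show "a + b \<in> I" using Gadd by (fastforce simp: I_def)
    next
      fix a b assume "a \<in> I"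
      then show "a * b \<in> I" using Gact by (fastforce simp: I_def)
    qed
    moreover have "module_hom_on (\<lambda>x a. x * a) act I h"
      unfolding module_hom_on_def
    proof (intro conjI ballI allI)
      fix a b assume "a \<in> I" "b \<in> I"
      then obtain y z where yz: "(actN x a, y) \<in> G" "(actN x b, z) \<in> G" by (auto simp: I_def)
      have "(actN x (a + b), y + z) \<in> G" using Gadd[OF yz] by simp
      with yz show "h (a + b) = h a + h b" by (simp add: h)
    next
      fix a b assume "a \<in> I"
      then obtain y where y: "(actN x a, y) \<in> G" by (auto simp: I_def)
      have "(actN x (a * b), act y b) \<in> G" using Gact[OF y, of b] by simp
      with y show "h (a * b) = act (h a) b" by (simp add: h)
    qed
    ultimately obtain e where e: "\<And>a. a \<in> I \<Longrightarrow> h a = act e a"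
      using inj_mod unfolding injective_module_def right_ideal_def by blast
    define X where "X = range (\<lambda>a. (actN x a, act e a))"
    have X: "submodule (pair_act actN act) X"
    proof (rule P.submoduleI)
      show "0 \<in> X" unfolding X_def by (rule range_eqI[of _ _ 0]) (simp add: zero_prod_def)
    next
      fix u v assume "u \<in> X" "v \<in> X"
      then obtain a b where "u = (actN x a, act e a)" "v = (actN x b, act e b)"
        by (auto simp: X_def)
      then show "u + v \<in> X" unfolding X_def by (intro range_eqI[of _ _ "a + b"]) simp
    next
      fix u b assume "u \<in> X"
      then obtain a where "u = (actN x a, act e a)" by (auto simp: X_def)
      then show "pair_act actN act u b \<in> X"
        unfolding X_def by (intro range_eqI[of _ _ "a * b"]) simp
    qed
    \<comment> \<open>Adding the pairs in \<open>X\<close> keeps the graph single-valued, since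
      \<open>act e a = h a\<close> wherever \<open>actN x a\<close> is already in the
      domain.\<close>
    let ?K = "{u + v | u v. u \<in> G \<and> v \<in> X}"
    have "?K \<subseteq> G"
    proof (rule max)
      show "submodule (pair_act actN act) ?K" by (rule P.submodule_sum[OF G X])
      show "G \<subseteq> ?K" by (rule P.summand_subset_sum(1)[OF G X])
      fix p q assume "p \<in> ?K"
      then obtain u a where u: "u \<in> G" and p: "p = u + (actN x a, act e a)"
        by (auto simp: X_def)
      show "fst p = 0 \<longrightarrow> snd p = 0"
      proof
        assume "fst p = 0"
        then have "fst u = - actN x a" using p by (simp add: eq_neg_iff_add_eq_0)
        then have "- u = (actN x a, - snd u)" by (simp add: prod_eq_iff)
        then have m: "(actN x a, - snd u) \<in> G" using P.submoduleD(4)[OF G u] by simp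
        then have "a \<in> I" by (auto simp: I_def)
        with e h[OF m] have "act e a = - snd u" by simp
        then show "snd p = 0" by (simp add: p)
      qed
    qed
    moreover have "(x, e) \<in> X" unfolding X_def by (rule range_eqI[of _ _ 1]) simp
    then have "(x, e) \<in> ?K" using P.summand_subset_sum(2)[OF G X] by blast
    ultimately show ?thesis by blast
  qed
  define g where "g x = (THE y. (x, y) \<in> G)" for x
  have g: "g x = y" if "(x, y) \<in> G" for x y
    unfolding g_def using that uniq by blast
  have gG: "(x, g x) \<in> G" for x using total[of x] g by blast
  have "module_hom_on actN act UNIV g"
    unfolding module_hom_on_def
  proof (intro conjI ballI allI)
    fix x y show "g (x + y) = g x + g y"
      using g Gadd[OF gG gG] by simp
  next
    fix x a show "g (actN x a) = act (g x) a"
      using g Gact[OF gG] by simp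
  qed
  then show thesis using that[of g] g sub by blast
qed

lemma (in injective_rmodule) extend_hom:
  assumes "right_module actN" "submodule actN L" "module_hom_on actN act L f"
  obtains g where "module_hom_on actN act UNIV g" "\<And>x. x \<in> L \<Longrightarrow> g x = f x"
proof -
  interpret N: rmodule actN by (rule rmodule.intro) fact
  interpret P: rmodule "pair_act actN act"
    by (rule rmodule.intro) (rule right_module_pair_act[OF assms(1) rmod])
  have f0: "f 0 = 0"
    using module_hom_on_zero_diff(1)[OF assms(3) N.rmodule_axioms assms(2)] .
  have "submodule (pair_act actN act) {(x, f x) | x. x \<in> L}"
    using assms(2,3) f0 N.submoduleD[OF assms(2)]
    by (intro P.submoduleI) (auto simp: module_hom_on_def zero_prod_def)
  then obtain g where "module_hom_on actN act UNIV g" "\<And>x y. (x, y) \<in> {(x, f x) | x. x \<in> L} \<Longrightarrow> g x = y"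
    by (rule extend_graph[OF assms(1)]) (use f0 in auto)
  then show thesis using that by blast
qed

section \<open>Endomorphisms and essential submodules\<close>

abbreviation (in rmodule) endo :: "('m \<Rightarrow> 'm) \<Rightarrow> bool" where
  "endo \<equiv> module_hom_on act act UNIV"

text \<open>Relative to \<open>X\<close>, because \<open>U\<close> is compared with the range of an
  idempotent endomorphism, which serves as an injective hull of \<open>U\<close> inside E.\<close>

definition (in rmodule) essential_in :: "'m set \<Rightarrow> 'm set \<Rightarrow> bool" where
  "essential_in U X \<longleftrightarrow> U \<subseteq> X \<and>
     (\<forall>V. submodule act V \<longrightarrow> V \<subseteq> X \<longrightarrow> V \<inter> U \<subseteq> {0} \<longrightarrow> V \<subseteq> {0})"

context rmodule
begin

lemma essential_inD:
  assumes "essential_in U X" "submodule act V" "V \<subseteq> X" "\<And>v. v \<in> V \<Longrightarrow> v \<in> U \<Longrightarrow> v = 0" "v \<in> V"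
  shows "v = 0"
  using assms unfolding essential_in_def by blast

lemma essential_in_mono:
  assumes "essential_in U X" "U \<subseteq> W" "W \<subseteq> X"
  shows "essential_in W X"
  using assms unfolding essential_in_def by blast

lemma endoI:
  assumes "\<And>x y. f (x + y) = f x + f y" "\<And>x a. f (act x a) = act (f x) a"
  shows "endo f"
  using assms by (simp add: module_hom_on_def)

lemma endo_simps:
  assumes "endo f"
  shows "f (x + y) = f x + f y" "f (act x a) = act (f x) a" "f 0 = 0" "f (- x) = - f x"
    "f (x - y) = f x - f y"
proof -
  show add: "f (x + y) = f x + f y" "f (act x a) = act (f x) a" for x y a
    using assms by (auto simp: module_hom_on_def)
  show "f 0 = 0" using add(2)[of 0 0] by simp
  show "f (- x) = - f x" using add(2)[of x "- 1"] by simp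
  show "f (x - y) = f x - f y" using add(1)[of "x - y" y] by (simp add: algebra_simps)
qed

lemma endo_id: "endo (\<lambda>x. x)"
  and endo_comp: "endo f \<Longrightarrow> endo g \<Longrightarrow> endo (\<lambda>x. f (g x))"
  and endo_add: "endo f \<Longrightarrow> endo g \<Longrightarrow> endo (\<lambda>x. f x + g x)"
  and endo_diff: "endo f \<Longrightarrow> endo g \<Longrightarrow> endo (\<lambda>x. f x - g x)"
  by (auto intro!: endoI simp: endo_simps algebra_simps)

lemma submodule_image:
  assumes "endo f" "submodule act V"
  shows "submodule act (f ` V)"
proof (rule submoduleI)
  show "0 \<in> f ` V"
    using submoduleD(1)[OF assms(2)] endo_simps(3)[OF assms(1)] by (metis imageI)
next
  fix x y assume "x \<in> f ` V" "y \<in> f ` V"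
  then show "x + y \<in> f ` V"
    using submoduleD(2)[OF assms(2)] by (auto simp flip: endo_simps(1)[OF assms(1)])
next
  fix x a assume "x \<in> f ` V"
  then show "act x a \<in> f ` V"
    using submoduleD(3)[OF assms(2)] by (auto simp flip: endo_simps(2)[OF assms(1)])
qed

lemma submodule_vimage:
  assumes "endo f" "submodule act V"
  shows "submodule act (f -` V)"
  using submoduleD[OF assms(2)] by (intro submoduleI) (auto simp: endo_simps[OF assms(1)])

lemma submodule_kernel: "endo f \<Longrightarrow> submodule act (f -` {0})"
  by (rule submodule_vimage[OF _ submodule_zero])

lemma inj_endoI:
  assumes "endo f" "\<And>x. f x = 0 \<Longrightarrow> x = 0"
  shows "inj f"
proof (rule injI)
  fix x y assume "f x = f y"
  then have "f (x - y) = 0" using endo_simps(5)[OF assms(1)] by simp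
  then show "x = y" using assms(2)[of "x - y"] by simp
qed

text \<open>Let \<open>V\<close> meet the kernel of \<open>n\<close> in 0. If \<open>p v\<close> is
  in \<open>U\<close>, then \<open>n v = n (p v) = 0\<close>, so \<open>v = 0\<close>. Hence
  \<open>p\<close> maps \<open>V\<close> to a submodule disjoint from \<open>U\<close>, so to 0, and
  \<open>n = n p\<close> vanishes on \<open>V\<close>.\<close>

lemma essential_kernel:
  assumes n: "endo n" and p: "endo p" and np: "\<And>x. n (p x) = n x"
    and U: "\<And>u. u \<in> U \<Longrightarrow> n u = 0" "essential_in U (range p)"
  shows "essential_in (n -` {0}) UNIV"
  unfolding essential_in_def
proof (intro conjI allI impI subsetI)
  fix V v assume V: "submodule act V" "V \<inter> n -` {0} \<subseteq> {0}" "v \<in> V"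
  have *: "w = 0" if "w \<in> V" "n w = 0" for w using V(2) that by blast
  have "p v = 0"
  proof (rule essential_inD[OF U(2) submodule_image[OF p V(1)]])
    fix w assume w: "w \<in> p ` V" "w \<in> U"
    then obtain v' where v': "v' \<in> V" "w = p v'" by blast
    then have "n v' = 0" using np[of v'] U(1)[OF w(2)] by simp
    then show "w = 0" using * v' endo_simps(3)[OF p] by auto
  qed (use V in auto)
  then have "n v = 0" using np[of v] endo_simps(3)[OF n] by simp
  then show "v \<in> {0}" using * V(3) by simp
qed auto

end

section \<open>Splitting off hulls, and criteria for automorphisms\<close>

context injective_rmodule
begin

text \<open>With \<open>Z \<supseteq> W\<close> a maximal complement of \<open>U\<close> and \<open>Y \<supseteq> U\<close> a maximal complement of \<open>Z\<close>, any extension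
  of the projection \<open>Y + Z \<rightarrow> Y\<close> to the whole module has range \<open>Y\<close> and kernel \<open>Z\<close>.\<close>
lemma essential_split:
  assumes U: "submodule act U" and W: "submodule act W" and UW: "\<And>u. u \<in> U \<Longrightarrow> u \<in> W \<Longrightarrow> u = 0"
  obtains q where "endo q" "\<And>x. q (q x) = q x" "\<And>w. w \<in> W \<Longrightarrow> q w = 0"
    "\<And>u. u \<in> U \<Longrightarrow> q u = u" "essential_in U (range q)"
proof -
  obtain Z where Z: "submodule act Z" "W \<subseteq> Z" and ZU: "\<And>x. x \<in> Z \<Longrightarrow> x \<in> U \<Longrightarrow> x = 0"
    and Zmax: "\<And>K. submodule act K \<Longrightarrow> Z \<subseteq> K \<Longrightarrow> (\<And>x. x \<in> K \<Longrightarrow> x \<in> U \<Longrightarrow> x = 0) \<Longrightarrow> K \<subseteq> Z"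
    by (rule maximal_submodule[OF W, where R = "\<lambda>x y. x \<in> U \<longrightarrow> x = 0"]) (use UW in auto)
  obtain Y where Y: "submodule act Y" "U \<subseteq> Y" and YZ: "\<And>x. x \<in> Y \<Longrightarrow> x \<in> Z \<Longrightarrow> x = 0"
    and Ymax: "\<And>K. submodule act K \<Longrightarrow> Y \<subseteq> K \<Longrightarrow> (\<And>x. x \<in> K \<Longrightarrow> x \<in> Z \<Longrightarrow> x = 0) \<Longrightarrow> K \<subseteq> Y"
    by (rule maximal_submodule[OF U, where R = "\<lambda>x y. x \<in> Z \<longrightarrow> x = 0"]) (use ZU in auto)
  let ?G = "{(y + z, y) | y z. y \<in> Y \<and> z \<in> Z}"
  interpret P: rmodule "pair_act act act"
    by (rule rmodule.intro) (rule right_module_pair_act[OF rmod rmod])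
  have "submodule (pair_act act act) ?G"
  proof (rule P.submoduleI)
    show "0 \<in> ?G" using submoduleD(1)[OF Y(1)] submoduleD(1)[OF Z(1)] by (force simp: zero_prod_def)
  next
    fix u v assume "u \<in> ?G" "v \<in> ?G"
    then obtain y z y' z' where "u = (y + z, y)" "v = (y' + z', y')"
      "y \<in> Y" "y' \<in> Y" "z \<in> Z" "z' \<in> Z" by blast
    moreover from this have "u + v = ((y + y') + (z + z'), y + y')" by (simp add: algebra_simps)
    ultimately show "u + v \<in> ?G"
      using submoduleD(2)[OF Y(1)] submoduleD(2)[OF Z(1)] by blast
  next
    fix u a assume "u \<in> ?G"
    then show "pair_act act act u a \<in> ?G"
      using submoduleD(3)[OF Y(1)] submoduleD(3)[OF Z(1)] by fastforce
  qed
  moreover have "y = 0" if "(0, y) \<in> ?G" for y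
  proof -
    from that obtain z where "y \<in> Y" "z \<in> Z" "y + z = 0" by auto
    moreover from this have "z = - y" by (simp add: eq_neg_iff_add_eq_0 add.commute)
    ultimately show ?thesis using YZ[of y] submoduleD(4)[OF Z(1), of z] by simp
  qed
  ultimately obtain q where q: "endo q" and qG: "\<And>x y. (x, y) \<in> ?G \<Longrightarrow> q x = y"
    by (rule extend_graph[OF rmod]) auto
  have qY: "q y = y" if "y \<in> Y" for y
    using that submoduleD(1)[OF Z(1)] by (intro qG) force
  have qZ: "q z = 0" if "z \<in> Z" for z
    using that submoduleD(1)[OF Y(1)] by (intro qG) force
  have qU: "q u = u" if "u \<in> U" for u using qY Y(2) that by blast
  have "range q \<subseteq> Y"
  proof (rule Ymax)
    show "submodule act (range q)" by (rule submodule_image[OF q submodule_UNIV])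
    show "Y \<subseteq> range q" using qY by (metis rangeI subsetI)
    fix x assume x: "x \<in> range q" "x \<in> Z"
    \<comment> \<open>The preimage of \<open>Z\<close> still meets \<open>U\<close> in 0, as
      \<open>q\<close> fixes \<open>U\<close>. By maximality only elements of \<open>Z\<close> are
      mapped into \<open>Z\<close>, and those go to 0.\<close>
    have "q -` Z \<subseteq> Z"
    proof (rule Zmax)
      show "submodule act (q -` Z)" by (rule submodule_vimage[OF q Z(1)])
      show "Z \<subseteq> q -` Z" using qZ submoduleD(1)[OF Z(1)] by auto
      fix u assume "u \<in> q -` Z" "u \<in> U"
      then show "u = 0" using qU ZU by auto
    qed
    with x qZ show "x = 0" by auto
  qed
  then have qq: "q (q x) = q x" for x using qY by blast
  have "essential_in U (range q)"
    unfolding essential_in_def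
  proof (intro conjI allI impI)
    show "U \<subseteq> range q" using qU by (metis rangeI subsetI)
    fix V assume V: "submodule act V" "V \<subseteq> range q" "V \<inter> U \<subseteq> {0}"
    have VY: "V \<subseteq> Y" using V \<open>range q \<subseteq> Y\<close> by blast
    let ?K = "{z + v | z v. z \<in> Z \<and> v \<in> V}"
    \<comment> \<open>If \<open>z + v\<close> lies in \<open>U\<close>, then
      \<open>v = q (z + v) = z + v\<close>, an element of both \<open>V\<close> and
      \<open>U\<close>.\<close>
    have "?K \<subseteq> Z"
    proof (rule Zmax)
      show "submodule act ?K" by (rule submodule_sum[OF Z(1) V(1)])
      show "Z \<subseteq> ?K" by (rule summand_subset_sum(1)[OF Z(1) V(1)])
      fix x assume "x \<in> ?K" "x \<in> U"
      then obtain z v where zv: "x = z + v" "z \<in> Z" "v \<in> V" by blast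
      then have "q x = v" using qZ qY VY by (simp add: endo_simps[OF q] subset_iff)
      then have "x = v" using qU \<open>x \<in> U\<close> by simp
      then show "x = 0" using V(3) zv \<open>x \<in> U\<close> by blast
    qed
    then have "V \<subseteq> Z" using summand_subset_sum(2)[OF Z(1) V(1)] by blast
    then show "V \<subseteq> {0}" using VY YZ by blast
  qed
  then show thesis using that[OF q qq] qZ Z(2) qU by blast
qed

text \<open>Injectivity of E extends the inverse of \<open>f\<close> on its range to a left inverse
  \<open>g\<close>. The kernel of \<open>g\<close> meets the essential range of \<open>f\<close> in
  0, so \<open>g\<close> is injective, and \<open>g (f (g x)) = g x\<close> gives surjectivity of
  \<open>f\<close>.\<close>

lemma bij_if_essential_range:
  assumes f: "endo f" and inj: "\<And>x. f x = 0 \<Longrightarrow> x = 0" and ess: "essential_in (range f) UNIV"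
  shows "bij f"
proof -
  have injf: "inj f" by (rule inj_endoI[OF f inj])
  have "module_hom_on act act (range f) (inv f)"
    unfolding module_hom_on_def
    using injf by (auto simp flip: endo_simps(1,2)[OF f])
  from extend_hom[OF rmod submodule_image[OF f submodule_UNIV] this]
  obtain g where g: "endo g" "\<And>x. g (f x) = x" using injf by (metis inv_f_f rangeI)
  have "x = 0" if "g x = 0" for x
  proof (rule essential_inD[OF ess submodule_kernel[OF g(1)]])
    fix v assume "v \<in> g -` {0}" "v \<in> range f"
    then show "v = 0" using g(2) endo_simps(3)[OF f] by auto
  qed (use that in auto)
  then have inj_g: "inj g" by (rule inj_endoI[OF g(1)])
  then have "f (g x) = x" for x using injD[OF inj_g, of "f (g x)" x] g(2) by simp
  then have "surj f" by (metis surjI)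
  with injf show ?thesis by (simp add: bij_def)
qed

text \<open>\<open>1 - n\<close> is the identity on the kernel of \<open>n\<close>, so its own
  kernel avoids that essential submodule and its range contains it.\<close>

lemma bij_diff_essential_kernel:
  assumes n: "endo n" and ess: "essential_in (n -` {0}) UNIV"
  shows "bij (\<lambda>x. x - n x)"
proof (rule bij_if_essential_range)
  show u: "endo (\<lambda>x. x - n x)" by (rule endo_diff[OF endo_id n])
  fix x assume "x - n x = 0"
  then have "x \<in> (\<lambda>x. x - n x) -` {0}" by simp
  then show "x = 0"
    by (rule essential_inD[OF ess submodule_kernel[OF u], rotated 2]) auto
next
  show "essential_in (range (\<lambda>x. x - n x)) UNIV"
    by (rule essential_in_mono[OF ess]) (auto simp: image_iff, metis diff_0_right)
qed

end

section \<open>Submodules closed under automorphisms\<close>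

text \<open>The field enters only through a central unit \<open>u\<close> such that \<open>u - 1\<close> is a unit as well:
  it makes \<open>1 + (u - 1) e\<close> invertible for every idempotent endomorphism \<open>e\<close>.\<close>
locale automorphism_closed_submodule = injective_rmodule act
  for act :: "'e::ab_group_add \<Rightarrow> 'a::ring_1 \<Rightarrow> 'e" +
  fixes S :: "'e set" and u v w :: 'a
  assumes sub_S: "submodule act S"
    and closed: "\<And>s x. endo s \<Longrightarrow> bij s \<Longrightarrow> x \<in> S \<Longrightarrow> s x \<in> S"
    and central: "\<And>a. u * a = a * u" "\<And>a. v * a = a * v"
    and units: "u * v = 1" "(u - 1) * w = 1"
begin

lemma essential_kernel_closed:
  assumes "endo n" "essential_in (n -` {0}) UNIV" "x \<in> S"
  shows "n x \<in> S"
proof -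
  have "x - n x \<in> S"
    using closed[OF endo_diff[OF endo_id assms(1)] bij_diff_essential_kernel] assms by blast
  then have "x - (x - n x) \<in> S" using submoduleD(5)[OF sub_S] assms(3) by blast
  then show ?thesis by simp
qed

lemma square_zero_closed:
  assumes n: "endo n" and "\<And>x. n (n x) = 0" and x: "x \<in> S"
  shows "n x \<in> S"
proof -
  have "bij (\<lambda>x. x + n x)"
    by (rule o_bij[where g = "\<lambda>x. x - n x"]) (auto simp: endo_simps[OF n] assms(2))
  then have "x + n x \<in> S" using closed[OF endo_add[OF endo_id n]] x by blast
  then have "x + n x - x \<in> S" using submoduleD(5)[OF sub_S] x by blast
  then show ?thesis by simp
qed

lemma idempotent_closed:
  assumes e: "endo e" and ee: "\<And>x. e (e x) = e x" and x: "x \<in> S"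
  shows "e x \<in> S"
proof -
  have cancel: "act (act y u) v = y" "act (act y v) u = y" for y
    using units(1) central(1)[of v] by (simp_all flip: act_simps(3))
  have cancel_diff: "act (act y (u - 1)) w = y" for y
    using act_simps(3)[of y "u - 1" w] unfolding units(2) act_simps(4) by (rule sym)
  have comm: "act (act y a) u = act (act y u) a" "act (act y a) v = act (act y v) a" for y a
    using central(1)[of a] central(2)[of a] by (simp_all flip: act_simps(3))
  \<comment> \<open>\<open>?s\<close> acts as \<open>u\<close> on the range of \<open>e\<close> and
    as the identity on its kernel; \<open>?t\<close> does the same with the inverse \<open>v\<close>
    of \<open>u\<close>.\<close>
  let ?s = "\<lambda>x. x + act (e x) (u - 1)" and ?t = "\<lambda>x. x + act (e x) (v - 1)"
  have s: "endo ?s"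
    by (rule endoI) (simp_all add: endo_simps[OF e] comm algebra_simps)
  have "bij ?s"
    by (rule o_bij[where g = ?t])
      (auto simp: fun_eq_iff endo_simps[OF e] ee cancel algebra_simps)
  then have "?s x - x \<in> S"
    using closed[OF s] submoduleD(5)[OF sub_S] x by blast
  then have "act (act (e x) (u - 1)) w \<in> S"
    using submoduleD(3)[OF sub_S] by (metis add_diff_cancel_left')
  then show ?thesis unfolding cancel_diff .
qed

text \<open>The hypothesis \<open>square_free\<close> says that the range of \<open>r\<close> has no nonzero submodule \<open>D\<close> that is
  disjoint from an isomorphic copy \<open>j ` D\<close> in that range. It makes \<open>g (1 - e) + e\<close> an automorphism,
  where \<open>e\<close> projects onto an injective hull of the kernel of \<open>g\<close>.\<close>
lemma corner_closed:
  assumes r: "endo r" and rr: "\<And>x. r (r x) = r x"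
    and square_free: "\<And>j D. endo j \<Longrightarrow> submodule act D \<Longrightarrow> D \<subseteq> range r \<Longrightarrow> (\<And>x. r (j x) = j x) \<Longrightarrow>
      (\<And>d. d \<in> D \<Longrightarrow> j d = 0 \<Longrightarrow> d = 0) \<Longrightarrow>
      (\<And>d d'. d \<in> D \<Longrightarrow> d' \<in> D \<Longrightarrow> d = j d' \<Longrightarrow> d = 0) \<Longrightarrow> D \<subseteq> {0}"
    and g: "endo g" and gr: "\<And>x. g (r x) = g x" and rg: "\<And>x. r (g x) = g x"
    and x: "x \<in> S"
  shows "g x \<in> S"
proof -
  obtain e where e: "endo e" and ee: "\<And>x. e (e x) = e x"
    and ker: "\<And>x. x \<in> g -` {0} \<Longrightarrow> e x = x" and ess: "essential_in (g -` {0}) (range e)"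
    by (rule essential_split[OF submodule_kernel[OF g] submodule_zero], blast, rule that)
  note simps = endo_simps[OF r] endo_simps[OF e] endo_simps[OF g]
  define g' where "g' x = g (x - e x)" for x
  have g': "endo g'"
    unfolding g'_def by (intro endo_comp[OF g] endo_diff endo_id e)
  define t where "t x = g' x + e x" for x
  have t: "endo t" unfolding t_def by (intro endo_add g' e)
  \<comment> \<open>\<open>g\<close> kills \<open>x - r x\<close>, so \<open>e\<close> fixes it: the
    complement of the range of \<open>r\<close> lies in the range of \<open>e\<close>, and being
    fixed by \<open>e\<close> can be tested on \<open>r x\<close>.\<close>
  have er: "e x - e (r x) = x - r x" for x
    using ker[of "x - r x"] by (simp add: simps gr)
  have "r x - e (r x) = x - e x" for x
    using er[of x] by (simp add: algebra_simps)
  then have g'r: "g' (r x) = g' x" for x by (simp add: g'_def)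
  have fix_r: "e x = x" if "e (r x) = r x" for x
    using er[of x] that by simp
  have g'0: "e x = x" if "g' x = 0" for x
    using ker[of "x - e x"] that unfolding g'_def by (simp add: simps ee)
  have "bij t"
  proof (rule bij_if_essential_range[OF t])
    fix x assume tx: "t x = 0"
    \<comment> \<open>For \<open>x\<close> in the kernel of \<open>t\<close>, the element
      \<open>x - e x\<close> lies in \<open>?V\<close>. On \<open>?V\<close> the map
      \<open>g\<close> is injective with values fixed by \<open>e\<close>, so \<open>?V\<close> and
      its image are disjoint copies; \<open>r\<close> moves this into the range of
      \<open>r\<close>.\<close>
    let ?V = "{y. e y = 0 \<and> e (g y) = g y}"
    have V: "submodule act ?V"
      by (rule submoduleI) (auto simp: simps)
    have "r ` ?V \<subseteq> {0}"
    proof (rule square_free[OF g' submodule_image[OF r V]])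
      fix d assume "d \<in> r ` ?V" "g' d = 0"
      then obtain y where y: "e y = 0" "d = r y" "g' y = 0" using g'r by auto
      then have "y = 0" using g'0 by force
      then show "d = 0" using y(2) by (simp add: simps)
    next
      fix d d' assume "d \<in> r ` ?V" "d' \<in> r ` ?V" "d = g' d'"
      then obtain y y' where y: "d = r y" "e y = 0" "e (g y') = g y'" "e y' = 0"
        and "d' = r y'" by blast
      with \<open>d = g' d'\<close> have "r y = g' (r y')" by simp
      then have "r y = g' y'" unfolding g'r .
      then have "r y = g y'" by (simp add: g'_def y)
      then have "e y = y" using y fix_r by simp
      then show "d = 0" using y by (simp add: simps)
    qed (auto simp: g'_def rg)
    moreover have "g (x - e x) = - e x"
      using tx unfolding t_def g'_def eq_neg_iff_add_eq_0 .
    then have "x - e x \<in> ?V"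
      by (simp add: simps(6-10) ee)
    ultimately have "r (x - e x) = 0" by blast
    then have "e (r (x - e x)) = r (x - e x)" by (simp only: simps(8))
    from fix_r[OF this] have "e (x - e x) = x - e x" .
    then have ex: "e x = x" by (simp add: simps ee)
    then show "x = 0" using tx by (simp add: t_def g'_def simps)
  next
    show "essential_in (range t) UNIV"
      unfolding essential_in_def
    proof (intro conjI allI impI)
      fix D assume D: "submodule act D" "D \<inter> range t \<subseteq> {0}"
      have fixed: "d = 0" if "d \<in> D" "e d = d" for d
      proof -
        have "d = t d" using that by (simp add: t_def g'_def simps)
        with D that show ?thesis by blast
      qed
      have "r ` D \<subseteq> {0}"
      proof (rule square_free[OF g' submodule_image[OF r D(1)]])
        fix d assume "d \<in> r ` D" "g' d = 0"
        then obtain y where y: "y \<in> D" "d = r y" "g' y = 0" using g'r by auto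
        then have "y = 0" using fixed g'0 by blast
        then show "d = 0" using y(2) by (simp add: simps)
      next
        fix d d' assume "d \<in> r ` D" "d' \<in> r ` D" "d = g' d'"
        then obtain y y' where y: "d = r y" "y \<in> D" and "d' = r y'" by blast
        with \<open>d = g' d'\<close> have ry: "r y = g' y'" using g'r by simp
        \<comment> \<open>A preimage of \<open>y = r y + (y - r y)\<close> under \<open>t\<close>:
          the first summand is \<open>t (y' - e y')\<close>, the second is fixed by \<open>e\<close>
          and hence by \<open>t\<close>.\<close>
        have "e (y - r y) = y - r y" using er[of y] by (simp add: simps)
        then have "t (y' - e y' + (y - r y)) = g' y' + (y - r y)"
          by (simp add: t_def g'_def simps ee)
        also have "\<dots> = y" using ry by simp
        finally have "y \<in> range t" by (rule range_eqI[OF sym])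
        then have "y = 0" using D(2) y(2) by blast
        then show "d = 0" using y(1) simps(3) by simp
      qed (auto simp: g'_def rg)
      then have "r d = 0" if "d \<in> D" for d using that by blast
      then have "e d = d" if "d \<in> D" for d
        using fix_r[of d] that simps(8) by simp
      then show "D \<subseteq> {0}" using fixed by auto
    qed auto
  qed
  then have "t x \<in> S" using closed[OF t] x by blast
  moreover have "e x \<in> S" by (rule idempotent_closed[OF e ee x])
  ultimately have "t x - e x \<in> S" using submoduleD(5)[OF sub_S] by blast
  \<comment> \<open>\<open>g = (t - e) + g e\<close>, and \<open>g e\<close> vanishes on the kernel
    of \<open>g\<close>, which is essential in the range of \<open>e\<close>.\<close>
  moreover have "g (e x) \<in> S"
  proof (rule essential_kernel_closed[OF endo_comp[OF g e] _ x])
    show "essential_in ((\<lambda>x. g (e x)) -` {0}) UNIV"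
      by (rule essential_kernel[OF endo_comp[OF g e] e _ _ ess]) (use ee ker in auto)
  qed
  ultimately have "t x - e x + g (e x) \<in> S" using submoduleD(2)[OF sub_S] by blast
  then show ?thesis by (simp add: t_def g'_def simps)
qed

lemma endo_closed:
  assumes f: "endo f" and x: "x \<in> S"
  shows "f x \<in> S"
proof -
  interpret P: rmodule "pair_act act act"
    by (rule rmodule.intro) (rule right_module_pair_act[OF rmod rmod])
  \<comment> \<open>\<open>H\<close> is the graph of the maximal isomorphism. The first condition
    makes it single-valued and injective, the second makes domain and range disjoint.\<close>
  obtain H where H: "submodule (pair_act act act) H"
    and HR: "\<And>p q. p \<in> H \<Longrightarrow> q \<in> H \<Longrightarrow>
      (fst p = 0 \<longleftrightarrow> snd p = 0) \<and> (fst p = snd q \<longrightarrow> fst p = 0)"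
    and Hmax: "\<And>K. submodule (pair_act act act) K \<Longrightarrow> H \<subseteq> K \<Longrightarrow>
      (\<And>p q. p \<in> K \<Longrightarrow> q \<in> K \<Longrightarrow>
        (fst p = 0 \<longleftrightarrow> snd p = 0) \<and> (fst p = snd q \<longrightarrow> fst p = 0)) \<Longrightarrow> K \<subseteq> H"
    by (rule maximal_submodule[OF P.submodule_zero,
        where R = "\<lambda>p q. (fst p = 0 \<longleftrightarrow> snd p = 0) \<and> (fst p = snd q \<longrightarrow> fst p = 0)"])
      auto
  note HD = P.submoduleD[OF H]
  have H00: "(0, 0) \<in> H" using HD(1) by (simp add: zero_prod_def)
  have Hadd: "(a + a', b + b') \<in> H" if "(a, b) \<in> H" "(a', b') \<in> H" for a b a' b'
    using HD(2)[OF that] by simp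
  have Hact: "(act a c, act b c) \<in> H" if "(a, b) \<in> H" for a b c
    using HD(3)[OF that] by simp
  have H0: "a = 0 \<longleftrightarrow> b = 0" if "(a, b) \<in> H" for a b
    using HR[OF that that] by simp
  define A where "A = {a. \<exists>b. (a, b) \<in> H}"
  define B where "B = {b. \<exists>a. (a, b) \<in> H}"
  have A: "submodule act A" and B: "submodule act B"
    unfolding A_def B_def using H00 by (auto intro!: submoduleI intro: Hadd Hact)
  have AB: "y = 0" if "y \<in> A" "y \<in> B" for y
    using that HR unfolding A_def B_def by fastforce
  obtain h where h: "endo h" and hH: "\<And>a b. (a, b) \<in> H \<Longrightarrow> h a = b"
    by (rule extend_graph[OF rmod H]) (use H0 in auto)
  have "submodule (pair_act act act) {(b, a) | a b. (a, b) \<in> H}"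
    using H00 by (auto intro!: P.submoduleI intro: Hadd Hact simp: zero_prod_def)
  then obtain k where k: "endo k" and kH: "\<And>a b. (a, b) \<in> H \<Longrightarrow> k b = a"
    by (rule extend_graph[OF rmod]) (use H0 in auto)
  obtain p0 where p0: "endo p0" "\<And>x. p0 (p0 x) = p0 x" "\<And>b. b \<in> B \<Longrightarrow> p0 b = 0"
    "\<And>a. a \<in> A \<Longrightarrow> p0 a = a" "essential_in A (range p0)"
    by (rule essential_split[OF A B], rule AB, assumption+, rule that)
  have BP: "b = 0" if "b \<in> B" "b \<in> range p0" for b
  proof -
    have "p0 b = b" using that(2) p0(2) by blast
    with p0(3)[OF that(1)] show ?thesis by simp
  qed
  obtain q where q: "endo q" and qq: "\<And>x. q (q x) = q x"
    and qp0: "\<And>y. y \<in> range p0 \<Longrightarrow> q y = 0"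
    and qB: "\<And>b. b \<in> B \<Longrightarrow> q b = b" and essB: "essential_in B (range q)"
    by (rule essential_split[OF B submodule_image[OF p0(1) submodule_UNIV]],
        rule BP, assumption+, rule that)
  \<comment> \<open>\<open>q p0 = 0\<close>, but \<open>p0 q\<close> need not vanish; \<open>p0 (1 - q)\<close> is orthogonal to \<open>q\<close> on both sides.\<close>
  define p where "p x = p0 (x - q x)" for x
  have p: "endo p"
    unfolding p_def by (intro endo_comp[OF p0(1)] endo_diff endo_id q)
  have qp: "q (p x) = 0" for x by (simp add: p_def qp0)
  have pq: "p (q x) = 0" for x by (simp add: p_def qq endo_simps[OF p0(1)])
  have pp: "p (p x) = p x" for x
    unfolding p_def[of "p x"] qp by (simp add: p_def p0(2))
  have qA: "q a = 0" if "a \<in> A" for a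
    using qp0[of a] p0(4)[OF that] by (metis rangeI)
  have pA: "p a = a" if "a \<in> A" for a
    using that by (simp add: p_def qA p0(4))
  have pB: "p b = 0" if "b \<in> B" for b
    using that by (simp add: p_def qB endo_simps[OF p0(1)])
  have essA: "essential_in A (range p)"
  proof -
    have "A \<subseteq> range p" using pA by (metis rangeI subsetI)
    moreover have "range p \<subseteq> range p0" by (auto simp: p_def)
    ultimately show ?thesis using p0(5) unfolding essential_in_def by blast
  qed
  note simps = endo_simps[OF f] endo_simps[OF h] endo_simps[OF k] endo_simps[OF p] endo_simps[OF q]
  note Sadd = submoduleD(2)[OF sub_S]

  \<comment> \<open>On \<open>C\<close> the round trip \<open>k' q' h'\<close> is the identity, so
    inserting it into \<open>p' f p'\<close> changes the map only by \<open>?n\<close>, whose kernel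
    is essential. Stated abstractly to serve both \<open>A\<close> and \<open>B\<close>.\<close>
  have corner: "p' (f (p' y)) \<in> S"
    if p': "endo p'" "\<And>x. p' (p' x) = p' x" "essential_in C (range p')"
      and q': "endo q'" "\<And>x. q' (q' x) = q' x" "\<And>x. q' (p' x) = 0" "\<And>x. p' (q' x) = 0"
      and h': "endo h'" "endo k'" "\<And>c. c \<in> C \<Longrightarrow> k' (q' (h' c)) = c"
      and C: "\<And>c. c \<in> C \<Longrightarrow> p' c = c" and y: "y \<in> S"
    for p' q' h' k' C y
  proof -
    note s = endo_simps[OF p'(1)] endo_simps[OF q'(1)] endo_simps[OF h'(1)] endo_simps[OF h'(2)] simps
    let ?n = "\<lambda>y. p' (f (p' y)) - p' (f (p' (k' (q' (h' (p' y))))))"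
    note comps = endo_comp[OF p'(1)] endo_comp[OF q'(1)] endo_comp[OF h'(1)] endo_comp[OF h'(2)]
      endo_comp[OF f] p'(1) q'(1)
    have n: "endo ?n" by (intro endo_diff comps)
    have "?n y \<in> S"
    proof (rule essential_kernel_closed[OF n _ y])
      show "essential_in (?n -` {0}) UNIV"
        by (rule essential_kernel[OF n p'(1) _ _ p'(3)]) (simp_all add: p' C h')
    qed
    moreover have "q' (h' (p' y)) \<in> S"
      by (rule square_zero_closed[OF _ _ y]) (intro comps, simp add: q' s)
    \<comment> \<open>Doubling the idempotent \<open>q'\<close> splits the product into two
      square-zero factors.\<close>
    then have "p' (f (p' (k' (q' (q' (h' (p' y))))))) \<in> S"
      by (rule square_zero_closed[where n = "\<lambda>z. p' (f (p' (k' (q' z))))", rotated 2])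
        (intro comps, simp add: q' s)
    ultimately have "?n y + p' (f (p' (k' (q' (h' (p' y)))))) \<in> S"
      using Sadd unfolding q'(2) by blast
    then show ?thesis by simp
  qed
  have off_diagonal: "f (e y) - e (f (e y)) \<in> S" if e: "endo e" "\<And>x. e (e x) = e x" and "y \<in> S" for e y
    by (rule square_zero_closed[OF _ _ \<open>y \<in> S\<close>])
      (intro endo_diff endo_comp[OF f] endo_comp[OF e(1)] e(1),
        simp add: endo_simps[OF e(1)] endo_simps[OF f] e(2))

  have pfp: "p (f (p x)) \<in> S"
  proof (rule corner[OF p pp essA q qq qp pq h k _ pA x])
    fix a assume "a \<in> A"
    then obtain b where ab: "(a, b) \<in> H" by (auto simp: A_def)
    then have "b \<in> B" by (auto simp: B_def)
    with ab show "k (q (h a)) = a" by (simp add: hH kH qB)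
  qed
  have qfq: "q (f (q x)) \<in> S"
  proof (rule corner[OF q qq essB p pp pq qp k h _ qB x])
    fix b assume "b \<in> B"
    then obtain a where ab: "(a, b) \<in> H" by (auto simp: B_def)
    then have "a \<in> A" by (auto simp: A_def)
    with ab show "h (p (k b)) = b" by (simp add: hH kH pA)
  qed

  define r where "r x = x - p x - q x" for x
  have r: "endo r" unfolding r_def by (intro endo_diff endo_id p q)
  have pr: "p (r x) = 0" and qr: "q (r x) = 0" for x
    by (simp_all add: r_def simps pp qq pq qp)
  have rr: "r (r x) = r x" for x unfolding r_def[of "r x"] by (simp add: pr qr)
  have rfr: "r (f (r x)) \<in> S"
  proof (rule corner_closed[OF r rr, where g = "\<lambda>x. r (f (r x))", OF _ _ _ _ x])
    \<comment> \<open>The graph of \<open>j\<close> on \<open>D\<close> is added to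
      \<open>H\<close>; applying \<open>p\<close> and \<open>q\<close> separates the summands, so
      \<open>K0\<close> and \<open>K1\<close> give the two conditions for \<open>H\<close>.
      Maximality forces \<open>D\<close> into \<open>A\<close>, where \<open>p\<close> is the
      identity, while \<open>p\<close> vanishes on \<open>D\<close>.\<close>
    fix j D
    assume j: "endo j" and D: "submodule act D" and "D \<subseteq> range r" and rj: "\<And>x. r (j x) = j x"
      and jD: "\<And>d. d \<in> D \<Longrightarrow> j d = 0 \<Longrightarrow> d = 0"
      and disj: "\<And>d d'. d \<in> D \<Longrightarrow> d' \<in> D \<Longrightarrow> d = j d' \<Longrightarrow> d = 0"
    have pd: "p d = 0" "q d = 0" if "d \<in> D" for d
      using that \<open>D \<subseteq> range r\<close> pr qr by auto
    have pj: "p (j d) = 0" "q (j d) = 0" for d using pr[of "j d"] qr[of "j d"] by (simp_all add: rj)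
    let ?J = "{(d, j d) | d. d \<in> D}"
    have J: "submodule (pair_act act act) ?J"
      using submoduleD[OF D] by (intro P.submoduleI) (auto simp: endo_simps[OF j] zero_prod_def)
    let ?K = "{y + z | y z. y \<in> H \<and> z \<in> ?J}"
    have K0: "a = 0 \<and> d = 0 \<and> b = 0"
      if ab: "(a, b) \<in> H" "d \<in> D" and z: "a + d = 0 \<or> b + j d = 0" for a b d
    proof -
      have *: "a \<in> A" "b \<in> B" using ab by (auto simp: A_def B_def)
      from z show ?thesis
      proof
        assume z: "a + d = 0"
        then have "p (a + d) = 0" by (simp add: simps)
        then have "a = 0" using * ab by (simp add: simps pA pd)
        with z H0[OF ab(1)] show ?thesis by simp
      next
        assume z: "b + j d = 0"
        then have "q (b + j d) = 0" by (simp add: simps)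
        then have "b = 0" using * ab by (simp add: simps qB pj)
        with z H0[OF ab(1)] jD[OF ab(2)] show ?thesis by simp
      qed
    qed
    have K1: "a + d = 0"
      if ab: "(a, b) \<in> H" "d \<in> D" "(a', b') \<in> H" "d' \<in> D" and eq: "a + d = b' + j d'" for a b d a' b' d'
    proof -
      have *: "a \<in> A" "b' \<in> B" using ab by (auto simp: A_def B_def)
      have "p (a + d) = p (b' + j d')" "q (a + d) = q (b' + j d')" using eq by simp_all
      then have "a = 0" "b' = 0" using * ab by (simp_all add: simps pA pB qA qB pd pj)
      with disj[OF ab(2,4)] eq show ?thesis by simp
    qed
    have "?K \<subseteq> H"
    proof (rule Hmax)
      show "submodule (pair_act act act) ?K" by (rule P.submodule_sum[OF H J])
      show "H \<subseteq> ?K" by (rule P.summand_subset_sum(1)[OF H J])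
      fix y z assume "y \<in> ?K" "z \<in> ?K"
      then obtain a b d a' b' d' where *: "(a, b) \<in> H" "d \<in> D" "(a', b') \<in> H" "d' \<in> D"
        and yz: "y = (a + d, b + j d)" "z = (a' + d', b' + j d')" by force
      show "(fst y = 0 \<longleftrightarrow> snd y = 0) \<and> (fst y = snd z \<longrightarrow> fst y = 0)"
        using K0[OF *(1,2)] K1[OF *] endo_simps(3)[OF j] by (auto simp: yz)
    qed
    then have "?J \<subseteq> H" using P.summand_subset_sum(2)[OF H J] by blast
    then have "D \<subseteq> A" by (auto simp: A_def)
    then show "D \<subseteq> {0}" using pA pd by force
  qed (intro endo_comp[OF r] endo_comp[OF f] r, simp_all add: rr)

  \<comment> \<open>\<open>f\<close> is the sum of \<open>e f e\<close> and
    \<open>(1 - e) f e\<close> over the idempotents \<open>p\<close>, \<open>q\<close>,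
    \<open>r\<close>, which add up to 1.\<close>
  have "p (f (p x)) + q (f (q x)) + r (f (r x)) + (f (p x) - p (f (p x)))
      + (f (q x) - q (f (q x))) + (f (r x) - r (f (r x))) \<in> S"
    by (intro Sadd off_diagonal pfp qfq rfr p pp q qq r rr x)
  also have "p (f (p x)) + q (f (q x)) + r (f (r x)) + (f (p x) - p (f (p x)))
      + (f (q x) - q (f (q x))) + (f (r x) - r (f (r x))) = f (p x + q x + r x)"
    by (simp add: simps algebra_simps)
  also have "p x + q x + r x = x" by (simp add: r_def)
  finally show ?thesis .
qed

end

section \<open>Central units from the field, and the equivalence\<close>

lemma field_gives_central_units:
  fixes phi :: "'k::field \<Rightarrow> 'a::ring_1"
  assumes phi: "F_algebra phi" and "\<exists>x y z :: 'k. x \<noteq> y \<and> y \<noteq> z \<and> x \<noteq> z"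
  obtains u v w where "\<And>a. u * a = a * u" "\<And>a. v * a = a * v" "u * v = 1" "(u - 1) * w = (1::'a)"
proof -
  have hom: "phi 1 = 1" "phi (x + y) = phi x + phi y" "phi (x * y) = phi x * phi y"
    "phi x * a = a * phi x" for x y a
    using phi unfolding F_algebra_def by blast+
  have phi_diff: "phi (x - y) = phi x - phi y" for x y
    using hom(2)[of "x - y" y] by (simp add: algebra_simps)
  \<comment> \<open>Among three distinct scalars one differs from both 0 and 1, so \<open>d\<close>
    and \<open>d - 1\<close> are invertible.\<close>
  obtain d :: 'k where d: "d \<noteq> 0" "d \<noteq> 1" using assms(2) by metis
  show thesis
  proof (rule that[of "phi d" "phi (inverse d)" "phi (inverse (d - 1))"])
    have inverse: "phi c * phi (inverse c) = 1" if "c \<noteq> 0" for c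
      using hom(3)[of c "inverse c"] hom(1) that by simp
    show "phi d * phi (inverse d) = 1" by (rule inverse[OF d(1)])
    show "(phi d - 1) * phi (inverse (d - 1)) = 1"
      using inverse[of "d - 1"] d(2) by (simp add: phi_diff hom(1))
  qed (rule hom(4))+
qed

theorem theorem5:
  fixes phi :: "'k::field \<Rightarrow> 'a::ring_1"
    and act :: "'m::ab_group_add \<Rightarrow> 'a \<Rightarrow> 'm"
    and actE :: "'e::ab_group_add \<Rightarrow> 'a \<Rightarrow> 'e"
    and iota :: "'m \<Rightarrow> 'e"
  assumes "F_algebra phi"
    and "\<exists>x y z :: 'k. x \<noteq> y \<and> y \<noteq> z \<and> x \<noteq> z"
    and "right_module act"
    and "injective_hull act actE iota"
  shows "automorphism_invariant actE iota \<longleftrightarrow> quasi_injective act"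
proof -
  have iota: "module_hom_on act actE UNIV iota" and inj: "inj iota"
    and ess: "essential_submodule actE (range iota)"
    and E: "right_module actE" "injective_module actE"
    using assms(4) by (auto simp: injective_hull_def)
  interpret M: rmodule act by (rule rmodule.intro) fact
  interpret E: injective_rmodule actE
    by (intro injective_rmodule.intro rmodule.intro injective_rmodule_axioms.intro E)
  have iota_add: "iota (x + y) = iota x + iota y" and iota_act: "iota (act x a) = actE (iota x) a"
    for x y a
    using iota by (auto simp: module_hom_on_def)
  have iota_zero: "iota 0 = 0"
    using module_hom_on_zero_diff(1)[OF iota M.rmodule_axioms M.submodule_UNIV] .
  have S: "submodule actE (range iota)"
    using ess by (simp add: essential_submodule_def)
  show ?thesis
  proof
    assume aut: "automorphism_invariant actE iota"
    obtain u v w :: 'a where uvw: "\<And>a. u * a = a * u" "\<And>a. v * a = a * v" "u * v = 1" "(u - 1) * w = 1"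
      by (rule field_gives_central_units[OF assms(1,2)]) (rule that)
    have closed: "s x \<in> range iota" if "E.endo s" "bij s" "x \<in> range iota" for s x
      using aut that unfolding automorphism_invariant_def module_automorphism_def by blast
    interpret automorphism_closed_submodule actE "range iota" u v w
      by unfold_locales (fact S closed uvw)+
    show "quasi_injective act"
      unfolding quasi_injective_def
    proof (intro allI impI)
      fix L f assume L: "submodule act L" and f: "module_hom_on act act L f"
      \<comment> \<open>\<open>f\<close> is transported along \<open>iota\<close>, extended to an
        endomorphism \<open>h\<close> of E, and \<open>h\<close> restricts to M by
        \<open>endo_closed\<close>.\<close>
      let ?G = "{(iota x, iota (f x)) | x. x \<in> L}"
      interpret P: rmodule "pair_act actE actE"
        by (rule rmodule.intro) (rule right_module_pair_act[OF E(1) E(1)])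
      note L' = M.submoduleD[OF L]
      have f_zero: "f 0 = 0" by (rule module_hom_on_zero_diff(1)[OF f M.rmodule_axioms L])
      have fL: "f (x + y) = f x + f y" "f (act x a) = act (f x) a" if "x \<in> L" "y \<in> L" for x y a
        using f that by (auto simp: module_hom_on_def)
      have "submodule (pair_act actE actE) ?G"
      proof (rule P.submoduleI)
        have "(iota 0, iota (f 0)) \<in> ?G" using L'(1) by blast
        then show "0 \<in> ?G" by (simp add: f_zero iota_zero zero_prod_def)
      next
        fix y z assume "y \<in> ?G" "z \<in> ?G"
        then obtain a b where ab: "y = (iota a, iota (f a))" "z = (iota b, iota (f b))" "a \<in> L" "b \<in> L"
          by blast
        then have "y + z = (iota (a + b), iota (f (a + b)))" by (simp add: fL iota_add)
        then show "y + z \<in> ?G" using L'(2) ab by blast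
      next
        fix y c assume "y \<in> ?G"
        then obtain a where a: "y = (iota a, iota (f a))" "a \<in> L" by blast
        then have "pair_act actE actE y c = (iota (act a c), iota (f (act a c)))"
          by (simp add: fL iota_act)
        then show "pair_act actE actE y c \<in> ?G" using L'(3) a by blast
      qed
      moreover have "y = 0" if "(0, y) \<in> ?G" for y
      proof -
        from that obtain x where x: "iota x = iota 0" "y = iota (f x)" by (auto simp: iota_zero)
        then have "x = 0" using injD[OF inj] by blast
        then show ?thesis using x by (simp add: f_zero iota_zero)
      qed
      ultimately obtain h where h: "E.endo h" and hG: "\<And>x y. (x, y) \<in> ?G \<Longrightarrow> h x = y"
        by (rule E.extend_graph[OF E(1)]) blast+
      define g where "g x = inv iota (h (iota x))" for x
      have g: "iota (g x) = h (iota x)" for x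
        unfolding g_def by (rule f_inv_into_f) (rule endo_closed[OF h rangeI])
      have "M.endo g"
      proof (rule M.endoI)
        fix x y
        have "iota (g (x + y)) = iota (g x + g y)"
          by (simp add: g iota_add E.endo_simps[OF h])
        then show "g (x + y) = g x + g y" using injD[OF inj] by blast
      next
        fix x a
        have "iota (g (act x a)) = iota (act (g x) a)"
          by (simp add: g iota_act E.endo_simps[OF h])
        then show "g (act x a) = act (g x) a" using injD[OF inj] by blast
      qed
      moreover have "g x = f x" if "x \<in> L" for x
      proof -
        have "iota (g x) = iota (f x)" unfolding g using that by (intro hG) blast
        then show ?thesis using injD[OF inj] by blast
      qed
      ultimately show "\<exists>g. M.endo g \<and> (\<forall>x\<in>L. g x = f x)" by blast
    qed
  next
    assume qi: "quasi_injective act"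
    show "automorphism_invariant actE iota"
      unfolding automorphism_invariant_def
    proof (intro allI impI)
      \<comment> \<open>\<open>s\<close> agrees on \<open>M\<close> with an endomorphism of \<open>M\<close>: the difference \<open>d\<close> has a range that meets
        the essential submodule \<open>M\<close> in \<open>0\<close>.\<close>
      fix s assume "module_automorphism actE s"
      then have s: "E.endo s" by (simp add: module_automorphism_def)
      define L where "L = {m. s (iota m) \<in> range iota}"
      define f where "f m = inv iota (s (iota m))" for m
      have f: "iota (f m) = s (iota m)" if "m \<in> L" for m
        unfolding f_def using that by (intro f_inv_into_f) (simp add: L_def)
      have L: "submodule act L"
        unfolding L_def using E.submoduleD[OF S]
        by (intro M.submoduleI) (auto simp only: mem_Collect_eq iota_add iota_act iota_zero E.endo_simps[OF s])
      have "module_hom_on act act L f"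
        unfolding module_hom_on_def
      proof (intro conjI ballI allI)
        fix x y assume "x \<in> L" "y \<in> L"
        then have "iota (f (x + y)) = iota (f x + f y)"
          using M.submoduleD(2)[OF L] by (simp add: f iota_add E.endo_simps[OF s])
        then show "f (x + y) = f x + f y" using injD[OF inj] by blast
      next
        fix x a assume "x \<in> L"
        then have "iota (f (act x a)) = iota (act (f x) a)"
          using M.submoduleD(3)[OF L] by (simp add: f iota_act E.endo_simps[OF s])
        then show "f (act x a) = act (f x) a" using injD[OF inj] by blast
      qed
      with qi L obtain g where g: "M.endo g" and gf: "\<And>x. x \<in> L \<Longrightarrow> g x = f x"
        unfolding quasi_injective_def by blast
      define d where "d m = s (iota m) - iota (g m)" for m
      have d_add: "d (x + y) = d x + d y" and d_act: "d (act x a) = actE (d x) a" for x y a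
        by (simp_all add: d_def iota_add iota_act M.endo_simps[OF g] E.endo_simps[OF s])
      have d_zero: "d 0 = 0" by (simp add: d_def iota_zero M.endo_simps[OF g] E.endo_simps[OF s])
      have "submodule actE (range d)"
      proof (rule E.submoduleI)
        show "0 \<in> range d" using d_zero by (metis rangeI)
      qed (auto simp flip: d_add d_act)
      moreover have "range d \<inter> range iota = {0}"
      proof -
        \<comment> \<open>If \<open>d m\<close> lies in M, so does
          \<open>s (iota m) = d m + iota (g m)\<close>; hence \<open>m\<close> is in
          \<open>L\<close>, where \<open>g\<close> agrees with \<open>s\<close>.\<close>
        have "d m = 0" if "d m \<in> range iota" for m
        proof -
          have "d m + iota (g m) \<in> range iota"
            using that E.submoduleD(2)[OF S] by blast
          then have "m \<in> L" by (simp add: d_def L_def)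
          then show ?thesis by (simp add: d_def gf f)
        qed
        moreover have "0 \<in> range d \<inter> range iota" using d_zero iota_zero by (metis IntI rangeI)
        ultimately show ?thesis by blast
      qed
      ultimately have "range d = {0}"
        using ess unfolding essential_submodule_def by blast
      then have "d m = 0" for m by blast
      then have "s (iota m) = iota (g m)" for m by (simp add: d_def)
      then show "s ` range iota \<subseteq> range iota" by auto
    qed
  qed
qed

end
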